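(* Let $G = \Theta_{2,2,2}$, and let $G_N$ denote its level-$N$ nested blow-up graph. For every integer $N \ge 0$, the number $T_N$ of induced subgraphs of $G_N$ isomorphic to the 4-cycle $C_4$ is exactly $$T_N = \frac{5^{N}}{1240}\left(6300\cdot 5^{3N} - 2945\cdot 5^{2N} + 372\cdot 5^{N} - 7\right).$$
   Context: All graphs are finite and simple. The theta graph $\Theta_{2,2,2}$ is the graph on 5 vertices and 6 edges consisting of two non-adjacent vertices joined by three internally disjoint paths of length 2 (i.e. vertices $a,b,x_1,x_2,x_3$ with edges $\{a,x_i\}$ and $\{b,x_i\}$ for $i=1,2,3$). The composition $G[H]$ of graphs $G$ and $H$ is the graph obtained by replacing each vertex $v \in V(G)$ by a copy $H_v \cong H$ (copies pairwise disjoint) and adding an edge between every vertex of $H_u$ and every vertex of $H_v$ whenever $\{u,v\} \in E(G)$. The nested blow-up graphs of $G$ are defined by $G_0 = G$ and $G_N = G[G_{N-1}]$ for $N \ge 1$. The number of induced subgraphs of $G_N$ isomorphic to $C_4$ is the number of 4-element vertex subsets $S \subseteq V(G_N)$ such that the subgraph of $G_N$ induced by $S$ is isomorphic to $C_4$. *)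

theory Defs
  imports Complex_Main
begin

record 'a graph =
  verts :: "'a set"
  edges :: "'a set set"

definition finite_simple_graph :: "'a graph \<Rightarrow> bool" where
  "finite_simple_graph G \<longleftrightarrow>
     finite (verts G) \<and> (\<forall>e\<in>edges G. e \<subseteq> verts G \<and> card e = 2)"

definition graph_iso :: "'a graph \<Rightarrow> 'b graph \<Rightarrow> bool" where
  "graph_iso G H \<longleftrightarrow>
     (\<exists>f. bij_betw f (verts G) (verts H) \<and>
          (\<forall>u\<in>verts G. \<forall>v\<in>verts G. {u, v} \<in> edges G \<longleftrightarrow> {f u, f v} \<in> edges H))"

definition induced_subgraph :: "'a graph \<Rightarrow> 'a set \<Rightarrow> 'a graph" where
  "induced_subgraph G S = \<lparr>verts = S, edges = {e \<in> edges G. e \<subseteq> S}\<rparr>"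

definition C4 :: "nat graph" where
  "C4 = \<lparr>verts = {0, 1, 2, 3}, edges = {{0, 1}, {1, 2}, {2, 3}, {3, 0}}\<rparr>"

definition num_induced_C4 :: "'a graph \<Rightarrow> nat" where
  "num_induced_C4 G =
     card {S. S \<subseteq> verts G \<and> card S = 4 \<and> graph_iso (induced_subgraph G S) C4}"

definition composition :: "'a graph \<Rightarrow> 'b graph \<Rightarrow> ('a \<times> 'b) graph" where
  "composition G H =
     \<lparr>verts = verts G \<times> verts H,
      edges = {{(u, x), (u, y)} | u x y. u \<in> verts G \<and> {x, y} \<in> edges H}
            \<union> {{(u, x), (v, y)} | u v x y.
                 {u, v} \<in> edges G \<and> x \<in> verts H \<and> y \<in> verts H}\<rparr>"

definition relabel :: "('a \<Rightarrow> 'b) \<Rightarrow> 'a graph \<Rightarrow> 'b graph" where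
  "relabel f G = \<lparr>verts = f ` verts G, edges = (\<lambda>e. f ` e) ` edges G\<rparr>"

text \<open>
  The vertex type of \<open>composition G H\<close> differs from that of \<open>H\<close>, so the iteration is carried
  out on lists: a vertex of the level-\<open>N\<close> graph is a list of \<open>N + 1\<close> vertices of \<open>G\<close>,
  outermost coordinate first. The two relabellings are injective, so they only rename vertices;
  see \<open>nested_blowup_0_iso\<close> and \<open>nested_blowup_Suc_iso\<close> below.
\<close>

fun nested_blowup :: "'a graph \<Rightarrow> nat \<Rightarrow> 'a list graph" where
  "nested_blowup G 0 = relabel (\<lambda>v. [v]) G"
| "nested_blowup G (Suc N) =
     relabel (\<lambda>(v, vs). v # vs) (composition G (nested_blowup G N))"

datatype theta_vertex = Va | Vb | Vx1 | Vx2 | Vx3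

definition theta222 :: "theta_vertex graph" where
  "theta222 =
     \<lparr>verts = {Va, Vb, Vx1, Vx2, Vx3},
      edges = {{Va, Vx1}, {Va, Vx2}, {Va, Vx3}, {Vb, Vx1}, {Vb, Vx2}, {Vb, Vx3}}\<rparr>"

lemma graph_iso_relabel:
  assumes "inj f"
  shows "graph_iso G (relabel f G)"
  unfolding graph_iso_def
proof (intro exI conjI ballI)
  show "bij_betw f (verts G) (verts (relabel f G))"
    using assms by (auto simp: bij_betw_def relabel_def intro: inj_on_subset)
next
  fix u v
  have "{f u, f v} = f ` {u, v}"
    by simp
  then show "{u, v} \<in> edges G \<longleftrightarrow> {f u, f v} \<in> edges (relabel f G)"
    using assms by (simp add: relabel_def image_iff inj_image_eq_iff del: image_insert)
qed

lemma nested_blowup_0_iso: "graph_iso G (nested_blowup G 0)"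
  by (simp add: graph_iso_relabel inj_def)

lemma nested_blowup_Suc_iso:
  "graph_iso (composition G (nested_blowup G N)) (nested_blowup G (Suc N))"
  by (simp add: graph_iso_relabel inj_def)

lemma finite_simple_graph_relabel:
  assumes "inj f" "finite_simple_graph G"
  shows "finite_simple_graph (relabel f G)"
  using assms
  by (auto simp: finite_simple_graph_def relabel_def card_image inj_on_subset)

lemma finite_simple_graph_composition:
  assumes "finite_simple_graph G" "finite_simple_graph H"
  shows "finite_simple_graph (composition G H)"
  using assms
  by (fastforce simp: finite_simple_graph_def composition_def card_2_iff doubleton_eq_iff)

lemma finite_simple_graph_nested_blowup:
  assumes "finite_simple_graph G"
  shows "finite_simple_graph (nested_blowup G N)"
  by (induction N)
    (simp_all add: assms finite_simple_graph_relabel finite_simple_graph_composition inj_def)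

lemma finite_simple_graph_theta222: "finite_simple_graph theta222"
  by (simp add: finite_simple_graph_def theta222_def)

end

theory Submission
  imports Defs
begin

text \<open>
  A four-cycle is determined by its two diagonals: two pairs of distinct non-adjacent vertices such
  that every vertex of one pair is adjacent to every vertex of the other. Choosing which diagonal
  comes first and orienting both of them gives \<open>2 * 2 * 2 = 8\<close> such descriptions of each induced
  four-cycle, so it suffices to count ordered pairs of oriented diagonals (\<open>card_ordered_C4s\<close>).
  Such tuples are convenient because membership is a conjunction of conditions on
  pairs of vertices, and in a composition \<open>G[H]\<close> each of these conditions is decided by \<open>G\<close> if
  the two outer coordinates differ, and by \<open>H\<close> if they agree.

  Consider the outer coordinates \<open>((a, c), (b, d))\<close> of an ordered four-cycle of \<open>G[H]\<close>. If
  \<open>a = b\<close>, then each of \<open>c\<close> and \<open>d\<close> equals \<open>a\<close>, for otherwise it would be both adjacent and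
  non-adjacent to \<open>a\<close>; the same holds for the other sides of the cycle. So either all
  four coordinates agree, or only coordinates on a common diagonal can agree. With
  \<open>n\<close> vertices in \<open>H\<close> and \<open>D(H)\<close> ordered non-edges this leaves five cases:
  \<^item> all four agree: an ordered four-cycle of \<open>H\<close> in one copy;
  \<^item> all are distinct: an ordered four-cycle of \<open>G\<close> with \<open>n^4\<close> arbitrary inner coordinates;
  \<^item> both diagonals collapse: an arc of \<open>G\<close> with a non-edge of \<open>H\<close> at each end,
    \<open>D(H)^2\<close> choices;
  \<^item> exactly one diagonal collapses (two symmetric cases): an induced path of length two
    in \<open>G\<close> with a non-edge of \<open>H\<close> at its centre, \<open>D(H) * n^2\<close> choices.

  This is \<open>card_ordered_C4s_composition\<close>; the similar count of \<open>D\<close> is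
  \<open>card_nonedges_composition\<close>. The theta graph has 5 vertices, 8 ordered non-edges, 12 arcs, 18
  induced paths of length two (with ordered ends) and 24 ordered four-cycles. With
  \<open>n = 5^(N + 1)\<close> vertices at level \<open>N\<close>, the counts at the next level satisfy
  \<open>D' = 5 D + 8 n^2\<close> and \<open>Q' = 5 Q + 24 n^4 + 12 D^2 + 36 D n^2\<close>, starting from \<open>D = 8\<close> and
  \<open>Q = 24\<close>. The solution is \<open>D = 2 * 5^N * (5^(N + 1) - 1)\<close>, and \<open>Q\<close> is eight times the
  claimed number.
\<close>

section \<open>Ordered non-edges and ordered four-cycles\<close>

definition nonedges :: "'a graph \<Rightarrow> ('a \<times> 'a) set" where
  "nonedges G = {(u, v). u \<in> verts G \<and> v \<in> verts G \<and> u \<noteq> v \<and> {u, v} \<notin> edges G}"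

definition arcs :: "'a graph \<Rightarrow> ('a \<times> 'a) set" where
  "arcs G = {(u, v). {u, v} \<in> edges G}"

text \<open>
  The centre of an induced path of length two comes first, followed by its two ends in either order.
\<close>

definition cherries :: "'a graph \<Rightarrow> ('a \<times> 'a \<times> 'a) set" where
  "cherries G = {(u, v, w). (v, w) \<in> nonedges G \<and> {u, v} \<in> edges G \<and> {u, w} \<in> edges G}"

text \<open>
  The cycle \<open>a - b - c - d - a\<close> is grouped by its diagonals rather than listed cyclically: a diagonal is
  then a non-edge, and the two possible collapses in a composition each affect one component only.
\<close>

definition ordered_C4s :: "'a graph \<Rightarrow> (('a \<times> 'a) \<times> ('a \<times> 'a)) set" where
  "ordered_C4s G = {((a, c), (b, d)). (a, c) \<in> nonedges G \<and> (b, d) \<in> nonedges G \<and>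
     {a, b} \<in> edges G \<and> {a, d} \<in> edges G \<and> {c, b} \<in> edges G \<and> {c, d} \<in> edges G}"

lemma edge_in_verts:
  assumes "finite_simple_graph G" "{u, v} \<in> edges G"
  shows "u \<in> verts G" "v \<in> verts G" "u \<noteq> v"
  using assms by (fastforce simp: finite_simple_graph_def)+

lemma no_loop: "finite_simple_graph G \<Longrightarrow> {u} \<notin> edges G"
  by (fastforce simp: finite_simple_graph_def)

lemma nonedgeD:
  assumes "(u, v) \<in> nonedges G"
  shows "u \<in> verts G" "v \<in> verts G" "{u, v} \<notin> edges G" "{v, u} \<notin> edges G"
  using assms by (auto simp: nonedges_def insert_commute)

lemma nonedge_irrefl: "(u, u) \<notin> nonedges G"
  by (simp add: nonedges_def)

lemma finite_nonedges: "finite_simple_graph G \<Longrightarrow> finite (nonedges G)"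
  by (rule finite_subset[of _ "verts G \<times> verts G"])
    (auto simp: nonedges_def finite_simple_graph_def)

lemma finite_ordered_C4s: "finite_simple_graph G \<Longrightarrow> finite (ordered_C4s G)"
  by (rule finite_subset[of _ "nonedges G \<times> nonedges G"])
    (auto simp: ordered_C4s_def finite_nonedges)

lemma bij_betw_nonedges:
  assumes bij: "bij_betw f (verts G) (verts H)"
    and hom: "\<And>u v. u \<in> verts G \<Longrightarrow> v \<in> verts G \<Longrightarrow>
      {u, v} \<in> edges G \<longleftrightarrow> {f u, f v} \<in> edges H"
  shows "bij_betw (map_prod f f) (nonedges G) (nonedges H)"
proof -
  have inj: "inj_on f (verts G)" and img: "verts H = f ` verts G"
    using bij by (auto simp: bij_betw_def)
  have "inj_on (map_prod f f) (nonedges G)"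
    using map_prod_inj_on[OF inj inj] by (rule inj_on_subset) (auto simp: nonedges_def)
  moreover have "map_prod f f ` nonedges G = nonedges H"
    by (auto simp: nonedges_def img hom inj_on_eq_iff[OF inj] image_iff)
  ultimately show ?thesis
    by (simp add: bij_betw_def)
qed

lemma card_nonedges_iso:
  assumes "graph_iso G H"
  shows "card (nonedges G) = card (nonedges H)"
  using assms bij_betw_nonedges bij_betw_same_card unfolding graph_iso_def by metis

lemma card_verts_iso: "graph_iso G H \<Longrightarrow> card (verts G) = card (verts H)"
  using bij_betw_same_card unfolding graph_iso_def by blast

lemma card_ordered_C4s_iso:
  assumes "graph_iso G H"
  shows "card (ordered_C4s G) = card (ordered_C4s H)"
proof -
  obtain f where bij: "bij_betw f (verts G) (verts H)"
    and hom: "\<And>u v. u \<in> verts G \<Longrightarrow> v \<in> verts G \<Longrightarrow>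
      {u, v} \<in> edges G \<longleftrightarrow> {f u, f v} \<in> edges H"
    using assms unfolding graph_iso_def by blast
  let ?g = "map_prod f f"
  have inj: "inj_on ?g (nonedges G)" and img: "nonedges H = ?g ` nonedges G"
    using bij_betw_nonedges[OF bij hom] by (auto simp: bij_betw_def)
  have verts: "u \<in> verts G \<and> v \<in> verts G" if "(u, v) \<in> nonedges G" for u v
    using that by (simp add: nonedges_def)
  have "inj_on (map_prod ?g ?g) (ordered_C4s G)"
    using map_prod_inj_on[OF inj inj] by (rule inj_on_subset) (auto simp: ordered_C4s_def)
  moreover have "map_prod ?g ?g ` ordered_C4s G = ordered_C4s H"
  proof (intro subset_antisym subsetI)
    fix t assume "t \<in> map_prod ?g ?g ` ordered_C4s G"
    then obtain a b c d where Q: "((a, c), (b, d)) \<in> ordered_C4s G"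
      and t_eq: "t = ((f a, f c), (f b, f d))"
      by (auto simp: ordered_C4s_def)
    have "(a, c) \<in> nonedges G" "(b, d) \<in> nonedges G"
      using Q by (auto simp: ordered_C4s_def)
    then show "t \<in> ordered_C4s H"
      using Q verts[of a c] verts[of b d]
      by (auto simp: ordered_C4s_def t_eq img hom[symmetric])
  next
    fix t assume t: "t \<in> ordered_C4s H"
    then obtain a b c d where ac: "(a, c) \<in> nonedges G" and bd: "(b, d) \<in> nonedges G"
      and t_eq: "t = ((f a, f c), (f b, f d))"
      by (auto simp: ordered_C4s_def img)
    have "((a, c), (b, d)) \<in> ordered_C4s G"
      using t ac bd verts[OF ac] verts[OF bd] by (simp add: ordered_C4s_def t_eq hom)
    then show "t \<in> map_prod ?g ?g ` ordered_C4s G"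
      unfolding t_eq by force
  qed
  ultimately show ?thesis
    by (metis card_image)
qed

section \<open>Eight ordered four-cycles per induced four-cycle\<close>

text \<open>
  The diagonals of the four-cycle on \<open>{0, 1, 2, 3}\<close> are \<open>{0, 2}\<close> and \<open>{1, 3}\<close>, so an isomorphism to it
  is the same as a choice of vertices \<open>a, b, c, d\<close> going to \<open>0, 1, 2, 3\<close> with diagonals
  \<open>(a, c)\<close> and \<open>(b, d)\<close>.
\<close>

lemma induced_C4_iff:
  assumes G: "finite_simple_graph G"
  shows "S \<subseteq> verts G \<and> card S = 4 \<and> graph_iso (induced_subgraph G S) C4 \<longleftrightarrow>
    (\<exists>a b c d. ((a, c), (b, d)) \<in> ordered_C4s G \<and> S = {a, b, c, d})" (is "?L \<longleftrightarrow> ?R")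
proof
  assume L: ?L
  then obtain f where bij: "bij_betw f S {0, 1, 2, 3 :: nat}"
    and hom: "\<And>u v. u \<in> S \<Longrightarrow> v \<in> S \<Longrightarrow> {u, v} \<in> edges G \<longleftrightarrow> {f u, f v} \<in> edges C4"
    unfolding graph_iso_def induced_subgraph_def by (auto simp: C4_def)
  define g where "g = inv_into S f"
  have gS: "g i \<in> S" and fg: "f (g i) = i" if "i \<in> {0, 1, 2, 3}" for i
    using bij that unfolding g_def by (metis bij_betw_def inv_into_into f_inv_into_f)+
  have S: "S = {g 0, g 1, g 2, g 3}"
    using bij_betw_imp_surj_on[OF bij_betw_inv_into[OF bij]] unfolding g_def by auto
  have ne: "g i \<noteq> g j" if "i \<in> {0, 1, 2, 3}" "j \<in> {0, 1, 2, 3}" "i \<noteq> j" for i j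
    using that fg by metis
  have E: "{g i, g j} \<in> edges G \<longleftrightarrow> {i, j} \<in> edges C4"
    if "i \<in> {0, 1, 2, 3}" "j \<in> {0, 1, 2, 3}" for i j
    using that by (simp only: hom gS fg)
  have "((g 0, g 2), (g 1, g 3)) \<in> ordered_C4s G"
    using L gS unfolding ordered_C4s_def nonedges_def
    by (auto simp: E ne C4_def doubleton_eq_iff subset_iff)
  then show ?R
    using S by blast
next
  assume ?R
  then obtain a b c d where Q: "((a, c), (b, d)) \<in> ordered_C4s G" and S: "S = {a, b, c, d}"
    by blast
  have ne: "a \<noteq> c" "b \<noteq> d" and V: "a \<in> verts G" "b \<in> verts G" "c \<in> verts G" "d \<in> verts G"
    and non: "{a, c} \<notin> edges G" "{b, d} \<notin> edges G"
    and E: "{a, b} \<in> edges G" "{a, d} \<in> edges G" "{c, b} \<in> edges G" "{c, d} \<in> edges G"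
    using Q by (auto simp: ordered_C4s_def nonedges_def)
  have ne': "a \<noteq> b" "a \<noteq> d" "c \<noteq> b" "c \<noteq> d"
    using E[THEN edge_in_verts(3)[OF G]] .
  note NE = ne ne' ne[symmetric] ne'[symmetric]
  have E': "{b, a} \<in> edges G" "{d, a} \<in> edges G" "{b, c} \<in> edges G" "{d, c} \<in> edges G"
    using E by (simp_all add: insert_commute)
  have non': "{c, a} \<notin> edges G" "{d, b} \<notin> edges G"
    using non by (simp_all add: insert_commute)
  define f :: "'a \<Rightarrow> nat" where
    "f x = (if x = a then 0 else if x = b then 1 else if x = c then 2 else 3)" for x
  have f: "f a = 0" "f b = 1" "f c = 2" "f d = 3"
    using NE by (auto simp: f_def)
  have "bij_betw f S {0, 1, 2, 3}"
    unfolding bij_betw_def inj_on_def S by (simp add: f)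
  moreover have "{u, v} \<in> edges G \<longleftrightarrow> {f u, f v} \<in> edges C4" if "u \<in> S" "v \<in> S" for u v
    using that unfolding S
    by (elim insertE emptyE)
      (simp_all add: f E E' non non' no_loop[OF G] C4_def doubleton_eq_iff)
  ultimately have "graph_iso (induced_subgraph G S) C4"
    unfolding graph_iso_def induced_subgraph_def
    by (intro exI[of _ f]) (auto simp: C4_def)
  moreover have "card S = 4"
    using NE by (simp add: S)
  ultimately show ?L
    using V by (simp add: S)
qed

text \<open>
  The graph induced on a four-cycle determines its diagonals as the only two non-edges. Hence the
  only freedom is the order of the diagonals and the orientation of each.
\<close>

lemma card_orderings_of_C4:
  assumes G: "finite_simple_graph G" and Q: "((a, c), (b, d)) \<in> ordered_C4s G"
  shows "card {((a', c'), (b', d')) |a' b' c' d'.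
    ((a', c'), (b', d')) \<in> ordered_C4s G \<and> {a, b, c, d} = {a', b', c', d'}} = 8" (is "card ?F = 8")
proof -
  have ne: "a \<noteq> c" "b \<noteq> d" and V: "a \<in> verts G" "b \<in> verts G" "c \<in> verts G" "d \<in> verts G"
    and non: "{a, c} \<notin> edges G" "{b, d} \<notin> edges G"
    and E: "{a, b} \<in> edges G" "{a, d} \<in> edges G" "{c, b} \<in> edges G" "{c, d} \<in> edges G"
    using Q by (auto simp: ordered_C4s_def nonedges_def)
  have ne': "a \<noteq> b" "a \<noteq> d" "c \<noteq> b" "c \<noteq> d"
    using E[THEN edge_in_verts(3)[OF G]] .
  note NE = ne ne' ne[symmetric] ne'[symmetric]
  have E': "{b, a} \<in> edges G" "{d, a} \<in> edges G" "{b, c} \<in> edges G" "{d, c} \<in> edges G"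
    using E by (simp_all add: insert_commute)
  have non': "{c, a} \<notin> edges G" "{d, b} \<notin> edges G"
    using non by (simp_all add: insert_commute)
  let ?X = "{(a, c), (c, a)}" and ?Y = "{(b, d), (d, b)}"
  have opp: "(u, v) \<in> ?X \<union> ?Y"
    if "(u, v) \<in> nonedges G" "u \<in> {a, b, c, d}" "v \<in> {a, b, c, d}" for u v
    using that E E' by (auto simp: nonedges_def)
  \<comment> \<open>A single diagonal cannot be used twice: that would make a vertex adjacent to itself.\<close>
  have "?F = ?X \<times> ?Y \<union> ?Y \<times> ?X"
  proof (intro subset_antisym subsetI)
    fix t assume "t \<in> ?F"
    then obtain a' b' c' d' where t: "t = ((a', c'), (b', d'))"
      and pq: "((a', c'), (b', d')) \<in> ordered_C4s G"
      and S: "{a, b, c, d} = {a', b', c', d'}"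
      by blast
    have non_t: "(a', c') \<in> nonedges G" "(b', d') \<in> nonedges G"
      using pq by (auto simp: ordered_C4s_def)
    have in_S: "a' \<in> {a, b, c, d}" "b' \<in> {a, b, c, d}" "c' \<in> {a, b, c, d}" "d' \<in> {a, b, c, d}"
      unfolding S by simp_all
    have "(a', c') \<in> ?X \<union> ?Y" "(b', d') \<in> ?X \<union> ?Y"
      using opp[OF non_t(1) in_S(1,3)] opp[OF non_t(2) in_S(2,4)] .
    then show "t \<in> ?X \<times> ?Y \<union> ?Y \<times> ?X"
      using pq by (elim UnE insertE emptyE) (simp_all add: t ordered_C4s_def no_loop[OF G])
  next
    fix t assume "t \<in> ?X \<times> ?Y \<union> ?Y \<times> ?X"
    then show "t \<in> ?F"
      by (elim UnE SigmaE insertE emptyE)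
        (simp_all add: V NE non non' E E' ordered_C4s_def nonedges_def insert_commute)
  qed
  also have "card (?X \<times> ?Y \<union> ?Y \<times> ?X) = card (?X \<times> ?Y) + card (?Y \<times> ?X)"
    using NE by (intro card_Un_disjoint) auto
  also have "\<dots> = 8"
    using NE by (simp add: card_cartesian_product)
  finally show ?thesis .
qed

text \<open>
  The ordered four-cycles are partitioned by their vertex sets, which are exactly the sets that
  induce a four-cycle.
\<close>

lemma card_ordered_C4s:
  assumes G: "finite_simple_graph G"
  shows "card (ordered_C4s G) = 8 * num_induced_C4 G"
proof -
  let ?I = "{S. S \<subseteq> verts G \<and> card S = 4 \<and> graph_iso (induced_subgraph G S) C4}"
  let ?F = "\<lambda>S. {((a, c), (b, d)) |a b c d. ((a, c), (b, d)) \<in> ordered_C4s G \<and> S = {a, b, c, d}}"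
  have "finite ?I"
    by (rule finite_subset[of _ "Pow (verts G)"])
      (use G in \<open>auto simp: finite_simple_graph_def\<close>)
  moreover have "\<forall>S\<in>?I. finite (?F S)"
    by (auto intro: finite_subset[OF _ finite_ordered_C4s[OF G]])
  moreover have "\<forall>S\<in>?I. \<forall>S'\<in>?I. S \<noteq> S' \<longrightarrow> ?F S \<inter> ?F S' = {}"
    by auto
  ultimately have "card (\<Union>S\<in>?I. ?F S) = (\<Sum>S\<in>?I. card (?F S))"
    by (rule card_UN_disjoint)
  also have "\<dots> = (\<Sum>S\<in>?I. 8)"
  proof (rule sum.cong[OF refl])
    fix S assume "S \<in> ?I"
    then obtain a b c d where Q: "((a, c), (b, d)) \<in> ordered_C4s G" and S: "S = {a, b, c, d}"
      unfolding mem_Collect_eq induced_C4_iff[OF G] by blast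
    show "card (?F S) = 8"
      unfolding S by (rule card_orderings_of_C4[OF G Q])
  qed
  also have "(\<Union>S\<in>?I. ?F S) = ordered_C4s G"
  proof (intro subset_antisym subsetI)
    fix t assume t: "t \<in> ordered_C4s G"
    then obtain a b c d where t_eq: "t = ((a, c), (b, d))"
      by (metis surj_pair)
    have "{a, b, c, d} \<in> ?I"
      unfolding mem_Collect_eq induced_C4_iff[OF G] using t[unfolded t_eq] by blast
    moreover have "t \<in> ?F {a, b, c, d}"
      unfolding t_eq mem_Collect_eq using t[unfolded t_eq] by fast
    ultimately show "t \<in> (\<Union>S\<in>?I. ?F S)"
      by (rule UN_I)
  qed auto
  finally show ?thesis
    by (simp add: num_induced_C4_def)
qed

section \<open>Counting in a composition\<close>

lemma edge_composition_iff:
  "{(u, x), (v, y)} \<in> edges (composition G H) \<longleftrightarrow>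
    u = v \<and> u \<in> verts G \<and> {x, y} \<in> edges H \<or>
    {u, v} \<in> edges G \<and> x \<in> verts H \<and> y \<in> verts H" (is "?l \<longleftrightarrow> ?r")
proof
  assume ?l
  then show ?r
    by (auto simp: composition_def doubleton_eq_iff insert_commute)
next
  assume ?r
  then show ?l
    unfolding composition_def by (simp; blast)
qed

lemma verts_composition: "verts (composition G H) = verts G \<times> verts H"
  by (simp add: composition_def)

lemma nonedge_composition_iff:
  assumes "finite_simple_graph G"
  shows "((u, x), (v, y)) \<in> nonedges (composition G H) \<longleftrightarrow>
    u = v \<and> u \<in> verts G \<and> (x, y) \<in> nonedges H \<or>
    (u, v) \<in> nonedges G \<and> x \<in> verts H \<and> y \<in> verts H"
  by (cases "u = v")
    (auto simp: nonedges_def edge_composition_iff verts_composition no_loop[OF assms])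

lemma card_verts_composition:
  "card (verts (composition G H)) = card (verts G) * card (verts H)"
  by (simp add: verts_composition card_cartesian_product)

text \<open>
  A non-edge of \<open>G[H]\<close> lies inside one copy of \<open>H\<close>, or projects to a non-edge of \<open>G\<close>.
\<close>

lemma card_nonedges_composition:
  assumes G: "finite_simple_graph G" and H: "finite_simple_graph H"
  shows "card (nonedges (composition G H)) =
    card (verts G) * card (nonedges H) + card (nonedges G) * card (verts H) ^ 2"
proof -
  let ?V = "verts H"
  let ?f = "\<lambda>(u, (x, y)). ((u, x), (u, y))"
  let ?g = "\<lambda>((u, v), (x, y)). ((u, x), (v, y))"
  let ?A = "verts G \<times> nonedges H" and ?B = "nonedges G \<times> (?V \<times> ?V)"
  have fin: "finite ?A" "finite ?B"
    using G H finite_nonedges by (auto simp: finite_simple_graph_def)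
  have "nonedges (composition G H) = ?f ` ?A \<union> ?g ` ?B"
  proof (intro subset_antisym subsetI)
    fix t assume t: "t \<in> nonedges (composition G H)"
    then obtain u x v y where t_eq: "t = ((u, x), (v, y))"
      by (metis surj_pair)
    consider "u = v" "(u, (x, y)) \<in> ?A" | "((u, v), (x, y)) \<in> ?B"
      using t by (auto simp: t_eq nonedge_composition_iff[OF G])
    then show "t \<in> ?f ` ?A \<union> ?g ` ?B"
      by cases (force simp: t_eq)+
  qed (auto simp: nonedge_composition_iff[OF G])
  moreover have "?f ` ?A \<inter> ?g ` ?B = {}"
    by (auto simp: nonedges_def)
  moreover have "card (?f ` ?A) = card ?A" "card (?g ` ?B) = card ?B"
    by (auto intro!: card_image simp: inj_on_def)
  ultimately show ?thesis
    using fin by (simp add: card_Un_disjoint card_cartesian_product power2_eq_square)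
qed

text \<open>
  The classes \<open>B1\<close> to \<open>B5\<close> of the proof are distinguished by which diagonals have equal outer
  coordinates: both, with all four coordinates equal (\<open>B1\<close>); neither (\<open>B2\<close>); both, at adjacent
  vertices of \<open>G\<close> (\<open>B3\<close>); only the first (\<open>B4\<close>); only the second (\<open>B5\<close>). Exchanging the diagonals
  matches \<open>B4\<close> with \<open>B5\<close>, which is the reason for the factor 2.
\<close>

lemma card_ordered_C4s_composition:
  assumes G: "finite_simple_graph G" and H: "finite_simple_graph H"
  shows "card (ordered_C4s (composition G H)) =
    card (verts G) * card (ordered_C4s H) + card (ordered_C4s G) * card (verts H) ^ 4 +
    card (arcs G) * card (nonedges H) ^ 2 +
    2 * (card (cherries G) * card (nonedges H) * card (verts H) ^ 2)"
proof -
  let ?V = "verts H" and ?D = "nonedges H"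
  let ?f1 = "\<lambda>(u, ((x, z), (y, w))). (((u, x), (u, z)), ((u, y), (u, w)))"
  let ?f2 = "\<lambda>(((a, c), (b, d)), ((x, z), (y, w))). (((a, x), (c, z)), ((b, y), (d, w)))"
  let ?f3 = "\<lambda>((a, b), ((x, z), (y, w))). (((a, x), (a, z)), ((b, y), (b, w)))"
  let ?f4 = "\<lambda>((a, b, d), ((x, z), (y, w))). (((a, x), (a, z)), ((b, y), (d, w)))"
  let ?f5 = "\<lambda>((a, b, d), ((x, z), (y, w))). (((b, y), (d, w)), ((a, x), (a, z)))"
  let ?A1 = "verts G \<times> ordered_C4s H"
  let ?A2 = "ordered_C4s G \<times> ((?V \<times> ?V) \<times> (?V \<times> ?V))"
  let ?A3 = "arcs G \<times> (?D \<times> ?D)"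
  let ?A4 = "cherries G \<times> (?D \<times> (?V \<times> ?V))"
  have fin_V: "finite (verts G)" "finite ?V"
    using G H by (simp_all add: finite_simple_graph_def)
  have fin_arcs: "finite (arcs G)"
    by (rule finite_subset[of _ "verts G \<times> verts G"])
      (auto simp: arcs_def fin_V dest: edge_in_verts(1,2)[OF G])
  have fin_cherries: "finite (cherries G)"
    by (rule finite_subset[of _ "verts G \<times> verts G \<times> verts G"])
      (auto simp: cherries_def fin_V dest: edge_in_verts(1,2)[OF G] nonedgeD(1,2))
  have fin: "finite ?A1" "finite ?A2" "finite ?A3" "finite ?A4"
    using fin_V fin_arcs fin_cherries finite_nonedges[OF H] finite_ordered_C4s[OF G]
      finite_ordered_C4s[OF H]
    by simp_all
  let ?Q = "ordered_C4s (composition G H)"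
  let ?B1 = "?f1 ` ?A1" and ?B2 = "?f2 ` ?A2" and ?B3 = "?f3 ` ?A3"
    and ?B4 = "?f4 ` ?A4" and ?B5 = "?f5 ` ?A4"
  note Q_simps = ordered_C4s_def nonedge_composition_iff[OF G] edge_composition_iff
  have Q_sub: "?Q \<subseteq> ?B1 \<union> ?B2 \<union> ?B3 \<union> ?B4 \<union> ?B5"
  proof
    fix t assume t: "t \<in> ?Q"
    obtain a x c z b y d w where t_eq: "t = (((a, x), (c, z)), ((b, y), (d, w)))"
      by (metis surj_pair)
    have
      ac: "a = c \<and> a \<in> verts G \<and> (x, z) \<in> ?D \<or> (a, c) \<in> nonedges G \<and> x \<in> ?V \<and> z \<in> ?V" and
      bd: "b = d \<and> b \<in> verts G \<and> (y, w) \<in> ?D \<or> (b, d) \<in> nonedges G \<and> y \<in> ?V \<and> w \<in> ?V" and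
      ab: "a = b \<and> {x, y} \<in> edges H \<or> {a, b} \<in> edges G" and
      ad: "a = d \<and> {x, w} \<in> edges H \<or> {a, d} \<in> edges G" and
      cb: "c = b \<and> {z, y} \<in> edges H \<or> {c, b} \<in> edges G" and
      cd: "c = d \<and> {z, w} \<in> edges H \<or> {c, d} \<in> edges G"
      using t unfolding t_eq by (simp_all add: Q_simps) blast+
    consider "a = c" "b = d" "c = d" | "a = c" "b = d" "a \<noteq> b" | "a = c" "b \<noteq> d"
      | "a \<noteq> c" "b = d" | "a \<noteq> c" "b \<noteq> d"
      by blast
    then have "t \<in> ?B1 \<or> t \<in> ?B2 \<or> t \<in> ?B3 \<or> t \<in> ?B4 \<or> t \<in> ?B5"
    proof cases
      case 1
      then have "(a, ((x, z), (y, w))) \<in> ?A1"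
        using ac bd ab ad cb cd no_loop[OF G] by (simp add: ordered_C4s_def nonedge_irrefl)
      then have "t \<in> ?B1"
        by (rule image_eqI[rotated]) (simp add: t_eq 1)
      then show ?thesis by blast
    next
      case 2
      then have "((a, b), ((x, z), (y, w))) \<in> ?A3"
        using ac bd ab by (simp add: arcs_def nonedge_irrefl)
      then have "t \<in> ?B3"
        by (rule image_eqI[rotated]) (simp add: t_eq 2)
      then show ?thesis by blast
    next
      case 3
      then have "((a, b, d), ((x, z), (y, w))) \<in> ?A4"
        using ac bd ab ad by (auto simp: cherries_def nonedge_irrefl dest: nonedgeD)
      then have "t \<in> ?B4"
        by (rule image_eqI[rotated]) (simp add: t_eq 3)
      then show ?thesis by blast
    next
      case 4
      then have "((b, a, c), ((y, w), (x, z))) \<in> ?A4"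
        using ac bd ab cb by (auto simp: cherries_def nonedge_irrefl insert_commute dest: nonedgeD)
      then have "t \<in> ?B5"
        by (rule image_eqI[rotated]) (simp add: t_eq 4)
      then show ?thesis by blast
    next
      case 5
      then have D: "(a, c) \<in> nonedges G" "(b, d) \<in> nonedges G" "x \<in> ?V" "z \<in> ?V" "y \<in> ?V" "w \<in> ?V"
        using ac bd by blast+
      \<comment> \<open>A coincidence such as \<open>a = b\<close> would make \<open>{b, d}\<close>, a non-edge, equal to the side \<open>{a, d}\<close>.\<close>
      then have "{a, b} \<in> edges G" "{a, d} \<in> edges G" "{c, b} \<in> edges G" "{c, d} \<in> edges G"
        using 5 ab ad cb cd nonedgeD(3,4)[OF D(1)] nonedgeD(3,4)[OF D(2)]
        by (elim disjE conjE; simp)+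
      then have "(((a, c), (b, d)), ((x, z), (y, w))) \<in> ?A2"
        using D by (simp add: ordered_C4s_def)
      then have "t \<in> ?B2"
        by (rule image_eqI[rotated]) (simp add: t_eq)
      then show ?thesis by blast
    qed
    then show "t \<in> ?B1 \<union> ?B2 \<union> ?B3 \<union> ?B4 \<union> ?B5"
      by blast
  qed
  have B12_sub: "?B1 \<subseteq> ?Q" "?B2 \<subseteq> ?Q"
    by (auto simp: Q_simps)
  have B3_sub: "?B3 \<subseteq> ?Q"
    by (auto simp: Q_simps arcs_def dest: edge_in_verts(1,2)[OF G] nonedgeD(1,2))
  have B45_sub: "?B4 \<subseteq> ?Q" "?B5 \<subseteq> ?Q"
    by (auto simp: Q_simps cherries_def insert_commute
        dest: edge_in_verts(1)[OF G] nonedgeD(1,2))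
  have "?Q = ?B1 \<union> ?B2 \<union> ?B3 \<union> ?B4 \<union> ?B5"
    by (intro subset_antisym Un_least Q_sub B12_sub B3_sub B45_sub)
  moreover have "?B1 \<inter> ?B2 = {}" "(?B1 \<union> ?B2) \<inter> ?B3 = {}" "(?B1 \<union> ?B2 \<union> ?B3) \<inter> ?B4 = {}"
    "(?B1 \<union> ?B2 \<union> ?B3 \<union> ?B4) \<inter> ?B5 = {}"
    by (auto simp: ordered_C4s_def arcs_def cherries_def nonedge_irrefl no_loop[OF G])
  moreover have "card ?B1 = card ?A1" "card ?B2 = card ?A2" "card ?B3 = card ?A3"
    "card ?B4 = card ?A4" "card ?B5 = card ?A4"
    by (auto intro!: card_image simp: inj_on_def)
  ultimately have "card ?Q = card ?A1 + card ?A2 + card ?A3 + card ?A4 + card ?A4"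
    using fin by (simp only: card_Un_disjoint finite_Un finite_imageI)
  then show ?thesis
    by (simp add: card_cartesian_product power2_eq_square power4_eq_xxxx algebra_simps)
qed

section \<open>The theta graph\<close>

text \<open>
  The theta graph is the complete bipartite graph with the two poles on one side and the three
  middle vertices on the other. In this form all the sets to be counted become unions of products,
  and no enumeration of tuples is necessary.
\<close>

lemma edge_theta222_iff:
  "{u, v} \<in> edges theta222 \<longleftrightarrow> (u \<in> {Va, Vb}) \<noteq> (v \<in> {Va, Vb})"
  by (cases u; cases v) (auto simp: theta222_def doubleton_eq_iff)

lemma verts_theta222: "verts theta222 = UNIV"
  using theta_vertex.exhaust by (auto simp: theta222_def)

lemma not_pole_iff: "v \<notin> {Va, Vb} \<longleftrightarrow> v \<in> {Vx1, Vx2, Vx3}"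
  by (cases v) auto

definition pole_pairs :: "(theta_vertex \<times> theta_vertex) set" where
  "pole_pairs = {(Va, Vb), (Vb, Va)}"

definition middle_pairs :: "(theta_vertex \<times> theta_vertex) set" where
  "middle_pairs = {(Vx1, Vx2), (Vx1, Vx3), (Vx2, Vx1), (Vx2, Vx3), (Vx3, Vx1), (Vx3, Vx2)}"

lemma mem_pole_pairs: "(u, v) \<in> pole_pairs \<longleftrightarrow> u \<noteq> v \<and> u \<in> {Va, Vb} \<and> v \<in> {Va, Vb}"
  by (auto simp: pole_pairs_def)

lemma mem_middle_pairs:
  "(u, v) \<in> middle_pairs \<longleftrightarrow> u \<noteq> v \<and> u \<notin> {Va, Vb} \<and> v \<notin> {Va, Vb}"
  unfolding not_pole_iff by (auto simp: middle_pairs_def)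

lemma nonedges_theta222: "nonedges theta222 = pole_pairs \<union> middle_pairs"
  unfolding nonedges_def verts_theta222 edge_theta222_iff
  by (auto simp only: mem_pole_pairs mem_middle_pairs Un_iff)

lemma card_pairs: "card pole_pairs = 2" "card middle_pairs = 6"
  "finite pole_pairs" "finite middle_pairs" "pole_pairs \<inter> middle_pairs = {}"
  by (simp_all add: pole_pairs_def middle_pairs_def)

lemma card_verts_theta222: "card (verts theta222) = 5"
  by (simp add: theta222_def)

lemma card_nonedges_theta222: "card (nonedges theta222) = 8"
  by (simp add: nonedges_theta222 card_Un_disjoint card_pairs)

lemma card_arcs_theta222: "card (arcs theta222) = 12"
proof -
  let ?P = "{Va, Vb}" and ?M = "{Vx1, Vx2, Vx3}"
  have middle: "?M = - ?P"
    using not_pole_iff by blast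
  have "arcs theta222 = ?P \<times> ?M \<union> ?M \<times> ?P"
    unfolding middle arcs_def edge_theta222_iff by auto
  then show ?thesis
    by (simp add: card_Un_disjoint)
qed

text \<open>
  The ends of an induced path of length two lie on the side opposite to its centre:
  \<open>2 * 6 + 3 * 2\<close> choices.
\<close>

lemma card_cherries_theta222: "card (cherries theta222) = 18"
proof -
  let ?P = "{Va, Vb}" and ?M = "{Vx1, Vx2, Vx3}"
  have middle: "?M = - ?P"
    using not_pole_iff by blast
  have "cherries theta222 = ?P \<times> middle_pairs \<union> ?M \<times> pole_pairs"
    unfolding middle cherries_def nonedges_theta222 edge_theta222_iff
    by (auto simp only: mem_pole_pairs mem_middle_pairs Un_iff mem_Sigma_iff Compl_iff)
  moreover have "?P \<times> middle_pairs \<inter> ?M \<times> pole_pairs = {}"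
    by auto
  ultimately show ?thesis
    by (simp add: card_Un_disjoint card_cartesian_product card_pairs)
qed

text \<open>
  One diagonal lies on each side, in either order: \<open>2 * 6 + 6 * 2\<close> choices.
\<close>

lemma card_ordered_C4s_theta222: "card (ordered_C4s theta222) = 24"
proof -
  have "ordered_C4s theta222 = pole_pairs \<times> middle_pairs \<union> middle_pairs \<times> pole_pairs"
    unfolding ordered_C4s_def nonedges_theta222 edge_theta222_iff
    by (auto simp only: mem_pole_pairs mem_middle_pairs Un_iff mem_Sigma_iff)
  moreover have "pole_pairs \<times> middle_pairs \<inter> middle_pairs \<times> pole_pairs = {}"
    using card_pairs(5) by auto
  ultimately show ?thesis
    by (simp add: card_Un_disjoint card_cartesian_product card_pairs)
qed

section \<open>Solving the recurrences\<close>

lemma card_verts_nested_blowup: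
  "card (verts (nested_blowup G N)) = card (verts G) ^ Suc N"
proof (induction N)
  case 0
  show ?case
    using card_verts_iso[OF nested_blowup_0_iso, of G] by simp
next
  case (Suc N)
  then show ?case
    using card_verts_iso[OF nested_blowup_Suc_iso, of G N] by (simp add: card_verts_composition)
qed

lemma card_nonedges_nested_theta222:
  "real (card (nonedges (nested_blowup theta222 N))) = 2 * 5 ^ N * (5 * 5 ^ N - 1)"
proof (induction N)
  case 0
  show ?case
    using card_nonedges_iso[OF nested_blowup_0_iso, of theta222]
    by (simp add: card_nonedges_theta222)
next
  case (Suc N)
  let ?H = "nested_blowup theta222 N"
  have "card (nonedges (nested_blowup theta222 (Suc N))) =
      5 * card (nonedges ?H) + 8 * (5 ^ Suc N) ^ 2"
    unfolding card_nonedges_iso[OF nested_blowup_Suc_iso, symmetric]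
      card_nonedges_composition[OF finite_simple_graph_theta222
        finite_simple_graph_nested_blowup[OF finite_simple_graph_theta222]]
      card_verts_nested_blowup card_verts_theta222 card_nonedges_theta222 ..
  then show ?case
    by (simp add: Suc.IH power2_eq_square algebra_simps)
qed

lemma card_ordered_C4s_nested_theta222:
  "real (card (ordered_C4s (nested_blowup theta222 N))) =
    5 ^ N / 155 * (6300 * (5 ^ N) ^ 3 - 2945 * (5 ^ N) ^ 2 + 372 * 5 ^ N - 7)"
proof (induction N)
  case 0
  show ?case
    using card_ordered_C4s_iso[OF nested_blowup_0_iso, of theta222]
    by (simp add: card_ordered_C4s_theta222)
next
  case (Suc N)
  let ?H = "nested_blowup theta222 N"
  have "card (ordered_C4s (nested_blowup theta222 (Suc N))) =
      5 * card (ordered_C4s ?H) + 24 * (5 ^ Suc N) ^ 4 + 12 * card (nonedges ?H) ^ 2 +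
      2 * (18 * card (nonedges ?H) * (5 ^ Suc N) ^ 2)"
    unfolding card_ordered_C4s_iso[OF nested_blowup_Suc_iso, symmetric]
      card_ordered_C4s_composition[OF finite_simple_graph_theta222
        finite_simple_graph_nested_blowup[OF finite_simple_graph_theta222]]
      card_verts_nested_blowup card_verts_theta222 card_ordered_C4s_theta222
      card_arcs_theta222 card_cherries_theta222 ..
  then have rec: "real (card (ordered_C4s (nested_blowup theta222 (Suc N)))) =
      5 * real (card (ordered_C4s ?H)) + 24 * (5 * 5 ^ N) ^ 4 +
      12 * real (card (nonedges ?H)) ^ 2 +
      36 * real (card (nonedges ?H)) * (5 * 5 ^ N) ^ 2"
    by simp
  define t :: real where "t = 5 ^ N"
  show ?case
    unfolding rec Suc.IH card_nonedges_nested_theta222 power_Suc t_def[symmetric]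
    by (simp add: field_simps power2_eq_square power3_eq_cube power4_eq_xxxx)
qed

theorem theorem2:
  fixes N :: nat
  shows "real (num_induced_C4 (nested_blowup theta222 N)) =
    5 ^ N / 1240 * (6300 * 5 ^ (3 * N) - 2945 * 5 ^ (2 * N) + 372 * 5 ^ N - 7)"
proof -
  have "8 * real (num_induced_C4 (nested_blowup theta222 N)) =
      real (card (ordered_C4s (nested_blowup theta222 N)))"
    by (simp add: card_ordered_C4s[OF
          finite_simple_graph_nested_blowup[OF finite_simple_graph_theta222]])
  then show ?thesis
    by (simp add: card_ordered_C4s_nested_theta222 mult.commute[of _ N] power_mult)
qed

end
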